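(* Let $c,\tilde{c}$ and $q$ be positive integers such that $\tilde{c}=\min\{c,6\}$ and $q\geq \max\{c+5, 50\tilde{c}+16\}$. If $G$ is a $\mu$-bounded graph with parameter $c$ and $\lambda_{\min}(G)\geq -3$, then the associated Hoffman graph $\mathfrak{g}(G,q)$ does not contain an induced Hoffman subgraph whose special matrix belongs to $\mathcal{M}(2)$.
   Context: A graph is $\mu$-bounded with parameter $c$ if each pair of distinct non-adjacent vertices has at most $c$ common neighbors; $\lambda_{\min}(G)$ is the smallest eigenvalue of the adjacency matrix of $G$. A Hoffman graph is a graph whose vertices are labelled fat or slim, such that no two fat vertices are adjacent and every fat vertex has at least one slim neighbor. An induced Hoffman subgraph is an induced subgraph with the labels preserved. If the adjacency matrix of a Hoffman graph $\mathfrak{h}$ is written as $\begin{pmatrix}A_{\rm slim} & D^T\\ D & O\end{pmatrix}$, where $A_{\rm slim}$ is the adjacency matrix of the subgraph induced on the slim vertices and $D$ is the fat–slim incidence matrix, then the special matrix of $\mathfrak{h}$ is $S(\mathfrak{h})=A_{\rm slim}-D^TD$. For an integer $q\geq 2$ and a $\mu$-bounded graph $G$, the associated Hoffman graph $\mathfrak{g}(G,q)$ has slim vertex set $V(G)$ with slim graph equal to $G$, and one fat vertex $f_C$ for each maximal clique $C$ of $G$ with at least $q$ vertices, where $f_C$ is adjacent precisely to the vertices of $C$. $\mathcal{M}(2)$ is the set of symmetric matrices consisting of: the $1\times1$ matrices $(-2+a)$ and the matrices $\begin{pmatrix}-2 & a\\ a & -2\end{pmatrix}$ for $a=-2,-3,\ldots$;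 the matrices $\begin{pmatrix}-3 & a\\ a & -2\end{pmatrix}$ and $\begin{pmatrix}-3 & a\\ a & -3\end{pmatrix}$ for $a=1,-1,-2,\ldots$; and the five matrices $\begin{pmatrix}-2&-1&-1\\-1&-2&-1\\-1&-1&-2\end{pmatrix}$, $\begin{pmatrix}-2&1&1\\1&-2&-1\\1&-1&-2\end{pmatrix}$, $\begin{pmatrix}-2&0&1\\0&-2&-1\\1&-1&-2\end{pmatrix}$, $\begin{pmatrix}-2&0&1\\0&-2&1\\1&1&-2\end{pmatrix}$, $\begin{pmatrix}-2&0&-1\\0&-2&-1\\-1&-1&-2\end{pmatrix}$. *)

theory Defs
  imports
    "Graph_Theory.Digraph_Component"
    "Graph_Theory.Pair_Digraph"
    "Jordan_Normal_Form.Char_Poly"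
    "HOL-Combinatorics.Multiset_Permutations"
begin

text \<open>
  Finite simple graphs are the symmetric digraphs \<^const>\<open>pair_graph\<close> over \<^typ>\<open>'a pair_pre_digraph\<close>:
  an edge between \<open>u\<close> and \<open>v\<close> is present as both pairs \<open>(u, v)\<close> and \<open>(v, u)\<close> in \<open>parcs G\<close>.
  Rows and columns of a \<^type>\<open>mat\<close> are numbers, so matrices attached to a graph are taken with
  respect to an enumeration of its vertices, i.e. an element of \<open>permutations_of_set\<close>.
\<close>

section \<open>Graphs\<close>

definition adjacency_matrix :: "'a pair_pre_digraph \<Rightarrow> 'a list \<Rightarrow> 'b::zero_neq_one mat" where
  "adjacency_matrix G vs =
     mat (length vs) (length vs) (\<lambda>(i, j). if (vs ! i, vs ! j) \<in> parcs G then 1 else 0)"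

definition graph_eigenvalues :: "'a pair_pre_digraph \<Rightarrow> real set" where
  "graph_eigenvalues G =
     {k. \<exists>vs \<in> permutations_of_set (pverts G). eigenvalue (adjacency_matrix G vs) k}"

text \<open>
  For a finite graph with at least one vertex this is a minimum over a finite nonempty set; on the
  graph without vertices the value is unspecified.
\<close>

definition lambda_min :: "'a pair_pre_digraph \<Rightarrow> real" where
  "lambda_min G = Min (graph_eigenvalues G)"

definition mu_bounded :: "'a pair_pre_digraph \<Rightarrow> nat \<Rightarrow> bool" where
  "mu_bounded G c \<longleftrightarrow>
     (\<forall>x \<in> pverts G. \<forall>y \<in> pverts G. x \<noteq> y \<and> (x, y) \<notin> parcs G \<longrightarrow>
        card {z \<in> pverts G. (x, z) \<in> parcs G \<and> (y, z) \<in> parcs G} \<le> c)"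

definition graph_clique :: "'a pair_pre_digraph \<Rightarrow> 'a set \<Rightarrow> bool" where
  "graph_clique G C \<longleftrightarrow>
     C \<subseteq> pverts G \<and> (\<forall>x \<in> C. \<forall>y \<in> C. x \<noteq> y \<longrightarrow> (x, y) \<in> parcs G)"

definition maximal_clique :: "'a pair_pre_digraph \<Rightarrow> 'a set \<Rightarrow> bool" where
  "maximal_clique G C \<longleftrightarrow>
     graph_clique G C \<and> (\<forall>C'. graph_clique G C' \<and> C \<subseteq> C' \<longrightarrow> C' = C)"

section \<open>Hoffman graphs\<close>

record 'a hoffman_graph =
  hgraph :: "'a pair_pre_digraph"
  fats :: "'a set"

definition slims :: "'a hoffman_graph \<Rightarrow> 'a set" where
  "slims h = pverts (hgraph h) - fats h"

definition is_hoffman_graph :: "'a hoffman_graph \<Rightarrow> bool" where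
  "is_hoffman_graph h \<longleftrightarrow>
     pair_graph (hgraph h) \<and> fats h \<subseteq> pverts (hgraph h) \<and>
     (\<forall>f \<in> fats h. \<forall>f' \<in> fats h. (f, f') \<notin> parcs (hgraph h)) \<and>
     (\<forall>f \<in> fats h. \<exists>s \<in> slims h. (f, s) \<in> parcs (hgraph h))"

text \<open>
  The subgraph has to be a Hoffman graph itself: each of its fat vertices keeps a slim neighbour.
\<close>

definition induced_hoffman_subgraph :: "'a hoffman_graph \<Rightarrow> 'a hoffman_graph \<Rightarrow> bool" where
  "induced_hoffman_subgraph h' h \<longleftrightarrow>
     is_hoffman_graph h \<and> is_hoffman_graph h' \<and>
     induced_subgraph (with_proj (hgraph h')) (with_proj (hgraph h)) \<and>
     fats h' = fats h \<inter> pverts (hgraph h')"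

definition fat_slim_incidence_matrix ::
    "'a hoffman_graph \<Rightarrow> 'a list \<Rightarrow> 'a list \<Rightarrow> int mat" where
  "fat_slim_incidence_matrix h fs ss =
     mat (length fs) (length ss) (\<lambda>(i, j). if (fs ! i, ss ! j) \<in> parcs (hgraph h) then 1 else 0)"

text \<open>
  Here \<open>fs\<close> and \<open>ss\<close> are meant to enumerate the fat and the slim vertices, so that
  \<open>adjacency_matrix (hgraph h) ss\<close> is the block \<open>A\<^sub>s\<^sub>l\<^sub>i\<^sub>m\<close>. The result does not depend on the order
  of \<open>fs\<close>; reordering \<open>ss\<close> permutes rows and columns simultaneously.
\<close>

definition special_matrix :: "'a hoffman_graph \<Rightarrow> 'a list \<Rightarrow> 'a list \<Rightarrow> int mat" where
  "special_matrix h fs ss =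
     adjacency_matrix (hgraph h) ss
     - transpose_mat (fat_slim_incidence_matrix h fs ss) * fat_slim_incidence_matrix h fs ss"

text \<open>
  A special matrix is determined up to the order of the slim vertices, hence it belongs to a set of
  matrices if it does so for some enumeration.
\<close>

definition special_matrix_belongs :: "'a hoffman_graph \<Rightarrow> int mat set \<Rightarrow> bool" where
  "special_matrix_belongs h \<M> \<longleftrightarrow>
     (\<exists>fs \<in> permutations_of_set (fats h). \<exists>ss \<in> permutations_of_set (slims h).
        special_matrix h fs ss \<in> \<M>)"

text \<open>
  In the associated Hoffman graph \<open>Inl v\<close> is the slim vertex \<open>v\<close> and \<open>Inr C\<close> the fat vertex \<open>f\<^sub>C\<close>.
\<close>

definition large_maximal_cliques :: "'a pair_pre_digraph \<Rightarrow> nat \<Rightarrow> 'a set set" where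
  "large_maximal_cliques G q = {C. maximal_clique G C \<and> q \<le> card C}"

definition associated_hoffman_graph ::
    "'a pair_pre_digraph \<Rightarrow> nat \<Rightarrow> ('a + 'a set) hoffman_graph" where
  "associated_hoffman_graph G q =
     \<lparr> hgraph =
         \<lparr> pverts = Inl ` pverts G \<union> Inr ` large_maximal_cliques G q,
           parcs = {(Inl u, Inl v) | u v. (u, v) \<in> parcs G}
                 \<union> {(Inl v, Inr C) | v C. C \<in> large_maximal_cliques G q \<and> v \<in> C}
                 \<union> {(Inr C, Inl v) | v C. C \<in> large_maximal_cliques G q \<and> v \<in> C} \<rparr>,
       fats = Inr ` large_maximal_cliques G q \<rparr>"

section \<open>The set of matrices \<open>\<M>(2)\<close>\<close>

definition M2 :: "int mat set" where
  "M2 =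
     {mat_of_rows_list 1 [[-2 + a]] | a. a \<le> -2}
   \<union> {mat_of_rows_list 2 [[-2, a], [a, -2]] | a. a \<le> -2}
   \<union> {mat_of_rows_list 2 [[-3, a], [a, -2]] | a. a = 1 \<or> a \<le> -1}
   \<union> {mat_of_rows_list 2 [[-3, a], [a, -3]] | a. a = 1 \<or> a \<le> -1}
   \<union> {mat_of_rows_list 3 [[-2, -1, -1], [-1, -2, -1], [-1, -1, -2]],
      mat_of_rows_list 3 [[-2, 1, 1], [1, -2, -1], [1, -1, -2]],
      mat_of_rows_list 3 [[-2, 0, 1], [0, -2, -1], [1, -1, -2]],
      mat_of_rows_list 3 [[-2, 0, 1], [0, -2, 1], [1, 1, -2]],
      mat_of_rows_list 3 [[-2, 0, -1], [0, -2, -1], [-1, -1, -2]]}"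

section \<open>Basic facts\<close>

lemma finite_graph_eigenvalues:
  assumes "finite (pverts G)"
  shows "finite (graph_eigenvalues G)"
proof -
  have "graph_eigenvalues G =
      (\<Union>vs \<in> permutations_of_set (pverts G). {k. eigenvalue (adjacency_matrix G vs) k})"
    by (auto simp: graph_eigenvalues_def)
  moreover have "finite {k. eigenvalue (adjacency_matrix G vs :: real mat) k}" for vs
  proof -
    have c: "(adjacency_matrix G vs :: real mat) \<in> carrier_mat (length vs) (length vs)"
      by (simp add: adjacency_matrix_def)
    then have "char_poly (adjacency_matrix G vs :: real mat) \<noteq> 0"
      using degree_monic_char_poly[OF c] by auto
    then show ?thesis
      using poly_roots_finite[of "char_poly (adjacency_matrix G vs :: real mat)"]
      by (simp add: eigenvalue_root_char_poly[OF c])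
  qed
  ultimately show ?thesis by simp
qed

lemma special_matrix_index:
  assumes "distinct fs" "i < length ss" "j < length ss"
  shows "special_matrix h fs ss $$ (i, j) =
    (if (ss ! i, ss ! j) \<in> parcs (hgraph h) then 1 else 0)
    - int (card {f \<in> set fs. (f, ss ! i) \<in> parcs (hgraph h) \<and> (f, ss ! j) \<in> parcs (hgraph h)})"
proof -
  let ?P = "\<lambda>f. (f, ss ! i) \<in> parcs (hgraph h) \<and> (f, ss ! j) \<in> parcs (hgraph h)"
  have "(\<Sum>k = 0..<length fs. (if ?P (fs ! k) then 1 else 0 :: int))
      = (\<Sum>f \<in> set fs. if ?P f then 1 else 0)"
    using assms(1) by (intro sum.reindex_bij_betw)
      (auto simp: bij_betw_def inj_on_def nth_eq_iff_index_eq in_set_conv_nth image_iff)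
  also have "\<dots> = int (card {f \<in> set fs. ?P f})"
    by (simp add: sum.If_cases Int_def)
  finally have card_eq: "int (card {f \<in> set fs. ?P f}) = (\<Sum>k = 0..<length fs. if ?P (fs ! k) then 1 else 0)"
    by simp
  have "special_matrix h fs ss $$ (i, j) =
      (if (ss ! i, ss ! j) \<in> parcs (hgraph h) then 1 else 0)
      - (\<Sum>k = 0..<length fs. (if (fs ! k, ss ! i) \<in> parcs (hgraph h) then 1 else 0) *
          (if (fs ! k, ss ! j) \<in> parcs (hgraph h) then 1 else 0))"
    using assms(2,3)
    by (simp add: special_matrix_def adjacency_matrix_def fat_slim_incidence_matrix_def
        scalar_prod_def)
  then show ?thesis
    unfolding card_eq by (simp add: if_conn cong: if_cong) (auto intro!: sum.cong)
qed

lemma slims_associated_hoffman_graph: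
  "slims (associated_hoffman_graph G q) = Inl ` pverts G"
  by (auto simp: slims_def associated_hoffman_graph_def)

lemma is_hoffman_graph_associated:
  assumes "pair_graph G" "q \<ge> 1"
  shows "is_hoffman_graph (associated_hoffman_graph G q)"
proof -
  interpret pair_graph G by fact
  let ?L = "large_maximal_cliques G q" and ?H = "hgraph (associated_hoffman_graph G q)"
  have L: "C \<subseteq> pverts G \<and> C \<noteq> {}" if "C \<in> ?L" for C
    using that assms(2)
    by (auto simp: large_maximal_cliques_def maximal_clique_def graph_clique_def)
  then have fin: "finite ?L"
    using pair_finite_verts by (intro finite_subset[of ?L "Pow (pverts G)"]) auto
  have "parcs ?H \<subseteq> pverts ?H \<times> pverts ?H"
    using L by (auto simp: associated_hoffman_graph_def dest: wellformed')
  moreover have finV: "finite (pverts ?H)"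
    using fin pair_finite_verts by (simp add: associated_hoffman_graph_def)
  ultimately have "finite (parcs ?H)"
    by (meson finite_SigmaI finite_subset)
  moreover have "sym (parcs ?H)"
    using pair_sym_arcs by (auto simp: associated_hoffman_graph_def sym_def symmetric_def)
  moreover have "fst e \<noteq> snd e" if "e \<in> parcs ?H" for e
    using that by (auto simp: associated_hoffman_graph_def dest: pair_no_loops)
  ultimately have "pair_graph ?H"
    using \<open>parcs ?H \<subseteq> _\<close> finV
    by unfold_locales (auto simp: symmetric_def)
  moreover have "\<exists>s \<in> slims (associated_hoffman_graph G q). (f, s) \<in> parcs ?H"
    if "f \<in> fats (associated_hoffman_graph G q)" for f
    using that L unfolding slims_associated_hoffman_graph
    by (fastforce simp: associated_hoffman_graph_def)
  ultimately show ?thesis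
    unfolding is_hoffman_graph_def by (auto simp: associated_hoffman_graph_def)
qed

end

theory Submission
  imports Defs "HOL-Analysis.Function_Topology"
begin

text \<open>
  Write \<open>A\<close> for the adjacency matrix of \<open>G\<close>. As \<open>A + 3\<close> is positive semidefinite, a test vector that
  is constant on a vertex outside a large maximal clique, on its neighbours and on its non-neighbours
  in the clique shows, together with the \<open>\<mu>\<close>-bound, that such a vertex has at most \<open>c'\<close> neighbours
  in the clique.

  Each matrix \<open>M\<close> in \<open>\<M>(2)\<close> admits a sign vector \<open>y\<close> with \<open>y\<^sup>T (M + 3) y \<le> -1\<close>. If \<open>M\<close> is a special
  matrix of an induced Hoffman subgraph, put the weights \<open>m y\<close> on its slim vertices and replace
  every fat vertex \<open>f\<^sub>C\<close> by \<open>m\<close> vertices of the clique \<open>C\<close>, each of weight minus the sum of \<open>y\<close> over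
  the slim vertices in \<open>C\<close>. The quadratic form of \<open>A + 3\<close> at this vector is
  \<open>m\<^sup>2 y\<^sup>T (M + 3) y\<close> up to an error linear in \<open>m\<close>, which \<open>m = 42 c' + 13\<close> is large enough to absorb.
\<close>

section \<open>The bilinear form of a shifted adjacency matrix\<close>

text \<open>With \<open>A\<close> the adjacency matrix this is \<open>f^T (A + k I) g\<close>,
  written over arcs and vertices so that no ordering of the vertices enters. An undirected edge
  contributes once for each orientation.\<close>

definition shifted_form :: "real \<Rightarrow> 'a pair_pre_digraph \<Rightarrow> ('a \<Rightarrow> real) \<Rightarrow> ('a \<Rightarrow> real) \<Rightarrow> real" where
  "shifted_form k G f g =
     (\<Sum>e \<in> parcs G. f (fst e) * g (snd e)) + k * (\<Sum>v \<in> pverts G. f v * g v)"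

lemma shifted_form_add_left:
  "shifted_form k G (\<lambda>v. f v + f' v) g = shifted_form k G f g + shifted_form k G f' g"
  by (simp add: shifted_form_def algebra_simps sum.distrib)

lemma shifted_form_mult_left:
  "shifted_form k G (\<lambda>v. a * f v) g = a * shifted_form k G f g"
  by (simp add: shifted_form_def algebra_simps sum_distrib_left)

lemma shifted_form_commute:
  assumes "pair_graph G"
  shows "shifted_form k G f g = shifted_form k G g f"
proof -
  interpret pair_graph G by fact
  have "prod.swap ` parcs G = parcs G"
    using pair_sym_arcs by (force simp: symmetric_def dest: symD)
  then have "(\<Sum>e \<in> parcs G. f (fst e) * g (snd e)) = (\<Sum>e \<in> parcs G. g (fst e) * f (snd e))"
    by (intro sum.reindex_bij_witness[of _ prod.swap prod.swap]) (auto simp: mult.commute)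
  then show ?thesis
    by (simp add: shifted_form_def mult.commute)
qed

lemma shifted_form_add_right:
  "shifted_form k G g (\<lambda>v. f v + f' v) = shifted_form k G g f + shifted_form k G g f'"
  by (simp add: shifted_form_def algebra_simps sum.distrib)

lemma shifted_form_mult_right:
  "shifted_form k G g (\<lambda>v. a * f v) = a * shifted_form k G g f"
  by (simp add: shifted_form_def algebra_simps sum_distrib_left)

lemma shifted_form_sum_left:
  "shifted_form k G (\<lambda>v. \<Sum>i \<in> I. f i v) g = (\<Sum>i \<in> I. shifted_form k G (f i) g)"
proof (induction I rule: infinite_finite_induct)
  case (insert i I)
  then show ?case by (simp add: shifted_form_add_left)
qed (simp_all add: shifted_form_def)

lemma shifted_form_sum_right:
  "shifted_form k G g (\<lambda>v. \<Sum>i \<in> I. f i v) = (\<Sum>i \<in> I. shifted_form k G g (f i))"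
proof (induction I rule: infinite_finite_induct)
  case (insert i I)
  then show ?case by (simp add: shifted_form_add_right)
qed (simp_all add: shifted_form_def)

lemma shifted_form_cong:
  assumes "pair_graph G" "\<And>v. v \<in> pverts G \<Longrightarrow> f v = f' v" "\<And>v. v \<in> pverts G \<Longrightarrow> g v = g' v"
  shows "shifted_form k G f g = shifted_form k G f' g'"
proof -
  interpret pair_graph G by fact
  have "(\<Sum>e \<in> parcs G. f (fst e) * g (snd e)) = (\<Sum>e \<in> parcs G. f' (fst e) * g' (snd e))"
    using assms(2,3) arc_fst_in_verts arc_snd_in_verts by (intro sum.cong) auto
  moreover have "(\<Sum>v \<in> pverts G. f v * g v) = (\<Sum>v \<in> pverts G. f' v * g' v)"
    using assms(2,3) by (intro sum.cong) auto
  ultimately show ?thesis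
    by (simp add: shifted_form_def)
qed

lemma shifted_form_indicator:
  assumes "pair_graph G" "S \<subseteq> pverts G"
  shows "shifted_form k G (indicator S) (indicator T) =
    real (card {e \<in> parcs G. fst e \<in> S \<and> snd e \<in> T}) + k * real (card (S \<inter> T))"
proof -
  interpret pair_graph G by fact
  have "(\<Sum>e \<in> parcs G. indicator S (fst e) * indicator T (snd e) :: real)
      = (\<Sum>e \<in> parcs G. if fst e \<in> S \<and> snd e \<in> T then 1 else 0)"
    by (intro sum.cong) (auto simp: indicator_def)
  also have "\<dots> = card {e \<in> parcs G. fst e \<in> S \<and> snd e \<in> T}"
    using pair_finite_arcs by (simp add: sum.If_cases Int_def)
  finally have 1: "(\<Sum>e \<in> parcs G. indicator S (fst e) * indicator T (snd e) :: real)
      = card {e \<in> parcs G. fst e \<in> S \<and> snd e \<in> T}" .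
  have "(\<Sum>v \<in> pverts G. indicator S v * indicator T v :: real)
      = (\<Sum>v \<in> pverts G. if v \<in> S \<inter> T then 1 else 0)"
    by (intro sum.cong) (auto simp: indicator_def)
  also have "\<dots> = card (S \<inter> T)"
  proof -
    have "{v \<in> pverts G. v \<in> S \<and> v \<in> T} = {v \<in> S. v \<in> T}"
      using assms(2) by blast
    then show ?thesis
      using pair_finite_verts by (simp add: sum.If_cases Int_def)
  qed
  finally show ?thesis
    using 1 by (simp add: shifted_form_def)
qed

section \<open>Positive semidefiniteness from the smallest eigenvalue\<close>

text \<open>Bridge from functions on vertices to the matrices behind \<open>lambda_min\<close>:
  listing the values of \<open>x\<close> along \<open>vs\<close> turns the vertexwise equations into
  one matrix equation.\<close>

lemma eigenvalue_adjacency_matrixI: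
  assumes G: "pair_graph G" and vs: "vs \<in> permutations_of_set (pverts G)"
    and nz: "\<exists>v \<in> pverts G. x v \<noteq> 0"
    and ev: "\<And>v. v \<in> pverts G \<Longrightarrow> (\<Sum>u \<in> pverts G. if (v, u) \<in> parcs G then x u else 0) = l * x v"
  shows "eigenvalue (adjacency_matrix G vs) (l :: real)"
proof -
  have set: "set vs = pverts G" "distinct vs"
    using vs by (auto simp: permutations_of_set_def)
  define n where "n = length vs"
  define w where "w = vec n (\<lambda>i. x (vs ! i))"
  have "w \<noteq> 0\<^sub>v n"
  proof
    assume "w = 0\<^sub>v n"
    then have "x (vs ! i) = 0" if "i < n" for i
      using that by (metis index_vec index_zero_vec(1) w_def)
    with nz set show False
      by (metis in_set_conv_nth n_def)
  qed
  moreover have "adjacency_matrix G vs *\<^sub>v w = l \<cdot>\<^sub>v w"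
  proof (rule eq_vecI)
    fix i assume "i < dim_vec (l \<cdot>\<^sub>v w)"
    then have i: "i < n" by (simp add: w_def)
    have "vec_index (adjacency_matrix G vs *\<^sub>v w) i
        = (\<Sum>j = 0..<n. if (vs ! i, vs ! j) \<in> parcs G then x (vs ! j) else 0)"
      using i unfolding adjacency_matrix_def n_def[symmetric]
      by (auto simp: scalar_prod_def w_def intro!: sum.cong)
    moreover have "(\<Sum>j = 0..<n. if (vs ! i, vs ! j) \<in> parcs G then x (vs ! j) else 0)
        = (\<Sum>u \<in> set vs. if (vs ! i, u) \<in> parcs G then x u else 0)"
      using set(2) by (intro sum.reindex_bij_betw)
        (auto simp: bij_betw_def inj_on_def nth_eq_iff_index_eq in_set_conv_nth image_iff n_def)
    moreover have "(\<Sum>u \<in> set vs. if (vs ! i, u) \<in> parcs G then x u else 0) = l * x (vs ! i)"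
      using i unfolding set(1) by (intro ev) (auto simp: n_def simp flip: set(1))
    ultimately show "vec_index (adjacency_matrix G vs *\<^sub>v w) i = vec_index (l \<cdot>\<^sub>v w) i"
      using i by (simp add: w_def)
  qed (simp add: adjacency_matrix_def w_def n_def)
  ultimately have "eigenvector (adjacency_matrix G vs) w l"
    by (simp add: eigenvector_def adjacency_matrix_def w_def n_def)
  then show ?thesis by (auto simp: eigenvalue_def)
qed

text \<open>Points of the sphere vanish off \<open>V\<close>, so it is a closed subset of a product
  of intervals \<open>[-1, 1]\<close> and singletons \<open>{0}\<close>, which is compact by
  Tychonoff's theorem. Hence a continuous form attains its minimum on the sphere if the sphere is
  nonempty.\<close>

lemma compact_unit_sphere_on:
  fixes V :: "'a set"
  assumes "finite V"
  shows "compact {x :: 'a \<Rightarrow> real. (\<forall>v. v \<notin> V \<longrightarrow> x v = 0) \<and> (\<Sum>v \<in> V. (x v)\<^sup>2) = 1}" (is "compact ?K")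
proof -
  let ?B = "\<Pi>\<^sub>E v \<in> UNIV. if v \<in> V then {-1..1 :: real} else {0}"
  have "compactin (product_topology (\<lambda>_. euclidean) UNIV) ?B"
    by (subst compactin_PiE) auto
  then have "compact ?B"
    by (simp add: euclidean_product_topology flip: compactin_euclidean_iff)
  moreover have "continuous_on UNIV (\<lambda>x :: 'a \<Rightarrow> real. \<Sum>v \<in> V. (x v)\<^sup>2)"
    by (intro continuous_intros continuous_on_product_coordinates)
  then have "closed ((\<lambda>x :: 'a \<Rightarrow> real. \<Sum>v \<in> V. (x v)\<^sup>2) -` {1})"
    by (auto intro: closed_vimage)
  moreover have "?K = ?B \<inter> (\<lambda>x. \<Sum>v \<in> V. (x v)\<^sup>2) -` {1}"
  proof -
    have "\<bar>x v\<bar> \<le> 1" if "(\<Sum>v \<in> V. (x v)\<^sup>2) = 1" "v \<in> V" for x :: "'a \<Rightarrow> real" and v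
      using member_le_sum[of v V "\<lambda>v. (x v)\<^sup>2"] that assms by (simp add: abs_square_le_1)
    then show ?thesis
      by (auto simp: PiE_iff abs_le_iff split: if_splits)
  qed
  ultimately show ?thesis
    by (simp add: compact_Int_closed)
qed

text \<open>The form of \<open>A\<close> has a minimum \<open>l\<close> on the unit sphere, and a
  minimiser \<open>x\<close> is an eigenvector for \<open>l\<close>, so
  \<open>lambda_min G \<le> l\<close>. Then \<open>A + k\<close> is the sum of \<open>A - l\<close>,
  nonnegative by minimality, and of \<open>k + l\<close>, a nonnegative multiple of the
  identity.\<close>

lemma shifted_form_nonneg:
  assumes G: "pair_graph G" and k: "- k \<le> lambda_min G"
  shows "0 \<le> shifted_form k G f f"
\<comment> \<open>A vertex with \<open>f v \<noteq> 0\<close> guarantees that the unit sphere is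
  nonempty, so that the minimum exists.\<close>
proof (cases "\<exists>v \<in> pverts G. f v \<noteq> 0")
  case False
  then have "shifted_form k G f f = shifted_form k G (\<lambda>_. 0) (\<lambda>_. 0)"
    using G by (intro shifted_form_cong) auto
  then show ?thesis by (simp add: shifted_form_def)
next
  case True
  interpret pair_graph G by fact
  let ?V = "pverts G" and ?A = "shifted_form 0 G"
  let ?K = "{x :: 'a \<Rightarrow> real. (\<forall>v. v \<notin> ?V \<longrightarrow> x v = 0) \<and> (\<Sum>v \<in> ?V. (x v)\<^sup>2) = 1}"
  have form_split: "shifted_form k G x y = ?A x y + k * (\<Sum>v \<in> ?V. x v * y v)" for k x y
    by (simp add: shifted_form_def)
  have norm: "\<exists>y \<in> ?K. \<exists>s > 0. \<forall>v \<in> ?V. x v = s * y v" if "\<exists>v \<in> ?V. x v \<noteq> 0" for x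
  proof -
    define s where "s = sqrt (\<Sum>v \<in> ?V. (x v)\<^sup>2)"
    have "(\<Sum>v \<in> ?V. (x v)\<^sup>2) > 0"
      using that pair_finite_verts by (auto intro: sum_pos2)
    then have s: "s > 0" "s\<^sup>2 = (\<Sum>v \<in> ?V. (x v)\<^sup>2)"
      by (simp_all add: s_def)
    then have "(\<Sum>v \<in> ?V. (x v / s)\<^sup>2) = 1"
      by (simp add: power_divide flip: sum_divide_distrib) (metis less_irrefl power_not_zero)
    moreover have "(\<Sum>v \<in> ?V. (if v \<in> ?V then x v / s else 0)\<^sup>2) = (\<Sum>v \<in> ?V. (x v / s)\<^sup>2)"
      by (intro sum.cong) auto
    ultimately have "(\<lambda>v. if v \<in> ?V then x v / s else 0) \<in> ?K"
      by simp
    then show ?thesis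
      using s(1) by (intro bexI[of _ "\<lambda>v. if v \<in> ?V then x v / s else 0"] exI[of _ s]) auto
  qed
  have "continuous_on ?K (\<lambda>x. ?A x x)"
    unfolding shifted_form_def
    by (intro continuous_intros continuous_on_subset[OF continuous_on_product_coordinates]) auto
  moreover have "?K \<noteq> {}"
    using norm[OF True] by blast
  ultimately have "\<exists>x \<in> ?K. \<forall>y \<in> ?K. ?A x x \<le> ?A y y"
    by (intro continuous_attains_inf[OF compact_unit_sphere_on[OF pair_finite_verts]])
  then obtain x where x: "x \<in> ?K" and min: "\<And>y. y \<in> ?K \<Longrightarrow> ?A x x \<le> ?A y y"
    by (elim bexE) auto
  define l where "l = ?A x x"
  have norm_x: "(\<Sum>v \<in> ?V. x v * x v) = 1"
    using x by (simp add: power2_eq_square)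
  have psd: "0 \<le> shifted_form (- l) G y y" for y
  proof (cases "\<exists>v \<in> ?V. y v \<noteq> 0")
    case False
    then have "shifted_form (- l) G y y = shifted_form (- l) G (\<lambda>_. 0) (\<lambda>_. 0)"
      using G by (intro shifted_form_cong) auto
    then show ?thesis by (simp add: shifted_form_def)
  next
    case True
    then obtain z s where z: "z \<in> ?K" and s: "s > 0" "\<forall>v \<in> ?V. y v = s * z v"
      using norm by blast
    have "shifted_form (- l) G y y = shifted_form (- l) G (\<lambda>v. s * z v) (\<lambda>v. s * z v)"
      using G s by (intro shifted_form_cong) auto
    also have "\<dots> = s * s * (?A z z - l)"
      using z by (simp add: shifted_form_mult_left shifted_form_mult_right form_split[of "- l"] power2_eq_square)
    finally show ?thesis
      using min[OF z] by (simp add: l_def)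
  qed
  \<comment> \<open>A nonnegative quadratic form that vanishes at \<open>x\<close> has
    \<open>x\<close> in its kernel: otherwise moving from \<open>x\<close> a little along
    \<open>z\<close> would make it negative.\<close>
  have crit: "shifted_form (- l) G z x = 0" for z
  proof -
    let ?b = "shifted_form (- l) G z x" and ?a = "shifted_form (- l) G z z"
    have xx: "shifted_form (- l) G x x = 0"
      using form_split[of "- l" x x] norm_x by (simp add: l_def)
    have q: "0 \<le> 2 * t * ?b + t * t * ?a" for t
    proof -
      have "shifted_form (- l) G (\<lambda>v. x v + t * z v) (\<lambda>v. x v + t * z v)
          = 0 + t * ?b + t * (?b + t * ?a)"
        by (simp only: shifted_form_add_left shifted_form_add_right shifted_form_mult_left
          shifted_form_mult_right xx shifted_form_commute[OF G, of "- l" x z] distrib_left)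
      then show ?thesis
        using psd[of "\<lambda>v. x v + t * z v"] by (simp add: algebra_simps)
    qed
    have "?a \<ge> 0" by (rule psd)
    \<comment> \<open>This is \<open>q\<close> at \<open>t = - ?b / (?a + 1)\<close>; the added 1
      keeps the denominator positive when \<open>?a = 0\<close>.\<close>
    have "0 \<le> 2 * (- ?b / (?a + 1)) * ?b + (- ?b / (?a + 1)) * (- ?b / (?a + 1)) * ?a"
      by (rule q)
    also have "\<dots> = - (?b * ?b * (?a + 2)) / ((?a + 1) * (?a + 1))"
      using \<open>?a \<ge> 0\<close> by (simp add: divide_simps) (simp add: algebra_simps)
    finally have "?b * ?b * (?a + 2) \<le> 0"
      using \<open>?a \<ge> 0\<close> by (simp add: divide_simps mult_le_0_iff split: if_splits)
    then show ?thesis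
      using \<open>?a \<ge> 0\<close> by (auto simp: mult_le_0_iff)
  qed
  \<comment> \<open>Testing \<open>crit\<close> against the indicator of \<open>v\<close> reads off
    the eigenvector equation at \<open>v\<close>.\<close>
  have "(\<Sum>u \<in> ?V. if (v, u) \<in> parcs G then x u else 0) = l * x v" if v: "v \<in> ?V" for v
  proof -
    have "(\<Sum>e \<in> parcs G. indicator {v} (fst e) * x (snd e)) = (\<Sum>e \<in> {e \<in> parcs G. fst e = v}. x (snd e))"
      using pair_finite_arcs by (intro sum.mono_neutral_cong_right) (auto simp: indicator_def)
    also have "\<dots> = (\<Sum>u \<in> {u \<in> ?V. (v, u) \<in> parcs G}. x u)"
      by (intro sum.reindex_bij_witness[of _ "\<lambda>u. (v, u)" snd]) (auto dest: wellformed')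
    also have "\<dots> = (\<Sum>u \<in> ?V. if (v, u) \<in> parcs G then x u else 0)"
      using pair_finite_verts by (simp add: sum.If_cases Int_def)
    finally have 1: "(\<Sum>e \<in> parcs G. indicator {v} (fst e) * x (snd e))
        = (\<Sum>u \<in> ?V. if (v, u) \<in> parcs G then x u else 0)" .
    have "(\<Sum>u \<in> ?V. indicator {v} u * x u) = (\<Sum>u \<in> {v}. x u)"
      using pair_finite_verts v by (intro sum.mono_neutral_cong_right) (auto simp: indicator_def)
    then show ?thesis
      using crit[of "indicator {v}"] 1 by (simp add: shifted_form_def)
  qed
  note eig = this
  obtain vs where vs: "vs \<in> permutations_of_set ?V"
    using finite_distinct_list[OF pair_finite_verts] by (auto simp: permutations_of_set_def)
  have "\<exists>v \<in> ?V. x v \<noteq> 0"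
  proof (rule ccontr)
    assume "\<not> ?thesis"
    then have "(\<Sum>v \<in> ?V. x v * x v) = 0"
      by (intro sum.neutral) auto
    then show False using norm_x by simp
  qed
  from eigenvalue_adjacency_matrixI[OF G vs this eig] have "l \<in> graph_eigenvalues G"
    using vs unfolding graph_eigenvalues_def by blast
  then have "lambda_min G \<le> l"
    unfolding lambda_min_def by (intro Min_le finite_graph_eigenvalues pair_finite_verts)
  then have "0 \<le> k + l" using k by simp
  moreover have "shifted_form k G f f = shifted_form (- l) G f f + (k + l) * (\<Sum>v \<in> ?V. f v * f v)"
    by (simp add: shifted_form_def algebra_simps)
  moreover have "0 \<le> (\<Sum>v \<in> ?V. f v * f v)"
    by (intro sum_nonneg) auto
  ultimately show ?thesis
    using psd[of f] by simp
qed

section \<open>Neighbours of a vertex in a clique that does not contain it\<close>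

text \<open>On a clique \<open>A\<close> is the all-ones matrix minus the identity, so the shift
  \<open>k\<close> acts as \<open>k - 1\<close>.\<close>

lemma shifted_form_clique:
  fixes k :: real
  assumes G: "pair_graph G" and C: "graph_clique G C" and S: "S \<subseteq> C" and T: "T \<subseteq> C"
  shows "shifted_form k G (indicator S) (indicator T) = card S * card T + (k - 1) * card (S \<inter> T)"
proof -
  interpret pair_graph G by fact
  have fin: "finite S" "finite T"
    using C S T finite_subset[OF _ pair_finite_verts] by (auto simp: graph_clique_def)
  have "{e \<in> parcs G. fst e \<in> S \<and> snd e \<in> T} = S \<times> T - (\<lambda>v. (v, v)) ` (S \<inter> T)"
    using C S T pair_no_loops by (fastforce simp: graph_clique_def)
  moreover have "card (S \<times> T - (\<lambda>v. (v, v)) ` (S \<inter> T)) = card (S \<times> T) - card (S \<inter> T)"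
    using fin by (subst card_Diff_subset) (auto simp: card_image inj_on_def)
  moreover have "card (S \<inter> T) \<le> card (S \<times> T)"
    using fin by (intro card_inj_on_le[of "\<lambda>v. (v, v)"]) (auto simp: inj_on_def)
  ultimately have "real (card {e \<in> parcs G. fst e \<in> S \<and> snd e \<in> T}) = card S * card T - real (card (S \<inter> T))"
    by (simp add: card_cartesian_product of_nat_diff)
  moreover have "S \<subseteq> pverts G"
    using C S by (auto simp: graph_clique_def)
  ultimately show ?thesis
    using shifted_form_indicator[OF G, of S k T] by (simp add: algebra_simps)
qed

lemma shifted_form_vertex:
  fixes k :: real
  assumes G: "pair_graph G" and v: "v \<in> pverts G"
  shows "shifted_form k G (indicator {v}) (indicator T) =
    card {u \<in> T. (v, u) \<in> parcs G} + (if v \<in> T then k else 0)"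
proof -
  have "card {e \<in> parcs G. fst e \<in> {v} \<and> snd e \<in> T} = card {u \<in> T. (v, u) \<in> parcs G}"
    by (rule bij_betw_same_card[of snd], rule bij_betw_byWitness[of _ "\<lambda>u. (v, u)"]) auto
  then show ?thesis
    using shifted_form_indicator[OF G, of "{v}" k T] v by simp
qed

text \<open>By maximality \<open>v\<close> misses some \<open>w\<close> in \<open>C\<close>, and
  then every neighbour of \<open>v\<close> in \<open>C\<close> is a common neighbour of the
  non-adjacent pair \<open>v\<close>, \<open>w\<close>.\<close>

lemma clique_nbrs_le_mu:
  assumes G: "pair_graph G" and mu: "mu_bounded G c" and C: "maximal_clique G C"
    and v: "v \<in> pverts G" "v \<notin> C"
  shows "card {u \<in> C. (v, u) \<in> parcs G} \<le> c"
proof -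
  interpret pair_graph G by fact
  have sym: "(b, a) \<in> parcs G" if "(a, b) \<in> parcs G" for a b
    using that pair_sym_arcs by (auto simp: symmetric_def dest: symD)
  have cl: "graph_clique G C" and max: "\<And>C'. graph_clique G C' \<Longrightarrow> C \<subseteq> C' \<Longrightarrow> C' = C"
    using C by (auto simp: maximal_clique_def)
  have "\<not> graph_clique G (insert v C)"
    using max[of "insert v C"] v(2) by blast
  then obtain w where w: "w \<in> C" "(v, w) \<notin> parcs G"
    using cl v(1) sym by (auto simp: graph_clique_def)
  have "{u \<in> C. (v, u) \<in> parcs G} \<subseteq> {z \<in> pverts G. (v, z) \<in> parcs G \<and> (w, z) \<in> parcs G}"
    using cl w by (auto simp: graph_clique_def)
  then have "card {u \<in> C. (v, u) \<in> parcs G} \<le> card {z \<in> pverts G. (v, z) \<in> parcs G \<and> (w, z) \<in> parcs G}"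
    using pair_finite_verts by (intro card_mono) auto
  also have "\<dots> \<le> c"
  proof -
    have "w \<in> pverts G" "v \<noteq> w"
      using v w cl by (auto simp: graph_clique_def)
    with mu v(1) w(2) show ?thesis
      unfolding mu_bounded_def by blast
  qed
  finally show ?thesis .
qed

text \<open>The form of \<open>A + 3\<close> on the indicators of \<open>v\<close>, its neighbours
  and its non-neighbours in \<open>C\<close> has a 3 by 3 Gram matrix with determinant
  \<open>a * b * (6 * (a + b + 2) - a * (b + 2))\<close>. An explicit test vector yields the sign of
  the last factor, also when \<open>b = 0\<close>.\<close>

lemma clique_nbrs_nonnbrs:
  assumes G: "pair_graph G" and lam: "-3 \<le> lambda_min G" and C: "graph_clique G C"
    and v: "v \<in> pverts G" "v \<notin> C"
  defines "a \<equiv> card {u \<in> C. (v, u) \<in> parcs G}"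
    and "b \<equiv> card {u \<in> C. (v, u) \<notin> parcs G}"
  shows "a * (b + 2) \<le> 6 * (a + b + 2)"
proof (cases "a = 0")
  case False
  let ?A = "{u \<in> C. (v, u) \<in> parcs G}" and ?B = "{u \<in> C. (v, u) \<notin> parcs G}"
  let ?v = "indicator {v} :: _ \<Rightarrow> real"
  let ?\<phi> = "shifted_form 3 G"
  have form: "?\<phi> ?v ?v = 3" "?\<phi> ?v (indicator ?A) = a" "?\<phi> ?v (indicator ?B) = 0"
    "?\<phi> (indicator ?A) (indicator ?A) = a * a + 2 * a"
    "?\<phi> (indicator ?B) (indicator ?B) = b * b + 2 * b"
    "?\<phi> (indicator ?A) (indicator ?B) = a * b"
  proof -
    interpret pair_graph G by fact
    have "(v, v) \<notin> parcs G" using pair_no_loops by fastforce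
    then have e: "{u \<in> {v}. (v, u) \<in> parcs G} = {}" by auto
    have e2: "{u \<in> ?A. (v, u) \<in> parcs G} = ?A" "{u \<in> ?B. (v, u) \<in> parcs G} = {}" by auto
    have "?A \<inter> ?B = {}" by auto
    then show "?\<phi> (indicator ?A) (indicator ?B) = a * b"
      using shifted_form_clique[OF G C, of ?A ?B 3] by (simp add: a_def b_def)
    show "?\<phi> ?v ?v = 3" "?\<phi> ?v (indicator ?A) = a" "?\<phi> ?v (indicator ?B) = 0"
      unfolding shifted_form_vertex[OF G v(1)] e e2 using v(2) by (simp_all add: a_def)
    show "?\<phi> (indicator ?A) (indicator ?A) = a * a + 2 * a"
      using shifted_form_clique[OF G C, of ?A ?A 3] by (simp add: a_def)
    show "?\<phi> (indicator ?B) (indicator ?B) = b * b + 2 * b"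
      using shifted_form_clique[OF G C, of ?B ?B 3] by (simp add: b_def)
  qed
  note com = shifted_form_commute[OF G, of 3 "indicator ?A" ?v] shifted_form_commute[OF G, of 3 "indicator ?B" ?v]
    shifted_form_commute[OF G, of 3 "indicator ?B" "indicator ?A"]
  let ?d = "real b + 2"
  \<comment> \<open>Up to the factor \<open>b\<close>, this is the middle column of the adjugate of
    the Gram matrix. The resulting vector is orthogonal, for the form, to the indicators of
    \<open>v\<close> and of its non-neighbours, so only its product with the neighbours contributes
    to the value.\<close>
  define \<alpha> \<beta> \<gamma> where "\<alpha> = - (real a * ?d)" and "\<beta> = 3 * ?d" and "\<gamma> = - (3 * real a)"
  let ?f = "\<lambda>u. \<alpha> * ?v u + (\<beta> * indicator ?A u + \<gamma> * indicator ?B u)"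
  have "0 \<le> ?\<phi> ?f ?f"
    by (rule shifted_form_nonneg[OF G lam])
  also have "?\<phi> ?f ?f = 3 * \<alpha>\<^sup>2 + \<beta>\<^sup>2 * (real a * a + 2 * a) + \<gamma>\<^sup>2 * (real b * b + 2 * b)
      + 2 * \<alpha> * \<beta> * a + 2 * \<beta> * \<gamma> * a * b"
    by (simp add: shifted_form_add_left shifted_form_add_right shifted_form_mult_left
        shifted_form_mult_right form com power2_eq_square algebra_simps)
  also have "\<dots> = 3 * a * ?d * (6 * (a + ?d) - a * ?d)"
    unfolding \<alpha>_def \<beta>_def \<gamma>_def by (simp add: power2_eq_square algebra_simps)
  finally have "a * ?d \<le> 6 * (a + ?d)"
    using False by (simp add: zero_le_mult_iff) linarith
  then have "real (a * (b + 2)) \<le> real (6 * (a + b + 2))"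
    by (simp add: algebra_simps)
  then show ?thesis
    unfolding of_nat_le_iff .
qed simp

text \<open>The previous inequality amounts to \<open>(a - 6) * (b - 4) \<le> 36\<close>. If
  \<open>a \<ge> 7\<close>, then \<open>a \<le> c\<close> and the size of \<open>C\<close> give
  \<open>b \<ge> 5\<close>, and both factors are positive integers whose sum is too large for this
  product.\<close>

lemma clique_nbrs_le:
  assumes G: "pair_graph G" and mu: "mu_bounded G c" and lam: "-3 \<le> lambda_min G"
    and C: "maximal_clique G C" "c + 5 \<le> card C" "48 \<le> card C \<or> c \<le> 6"
    and v: "v \<in> pverts G" "v \<notin> C"
  shows "card {u \<in> C. (v, u) \<in> parcs G} \<le> min c 6"
proof (rule ccontr)
  interpret pair_graph G by fact
  define a where "a = card {u \<in> C. (v, u) \<in> parcs G}"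
  define b where "b = card {u \<in> C. (v, u) \<notin> parcs G}"
  assume "\<not> ?thesis"
  moreover have ac: "a \<le> c"
    unfolding a_def by (rule clique_nbrs_le_mu[OF G mu C(1) v])
  ultimately have a: "7 \<le> a" and c: "48 \<le> card C"
    using C(3) by (auto simp: a_def)
  have cl: "graph_clique G C" using C(1) by (simp add: maximal_clique_def)
  then have "finite C"
    using finite_subset[OF _ pair_finite_verts] by (auto simp: graph_clique_def)
  then have ab: "a + b = card C"
    unfolding a_def b_def by (subst card_Un_disjoint[symmetric]) (auto intro!: arg_cong[of _ _ card])
  obtain a' where a': "a = a' + 7" using a by (metis le_add_diff_inverse2)
  have "5 \<le> b" using ab ac C(2) by simp
  then obtain b' where b': "b = b' + 5" by (metis le_add_diff_inverse2)
  have "a * (b + 2) \<le> 6 * (a + b + 2)"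
    unfolding a_def b_def by (rule clique_nbrs_nonnbrs[OF G lam cl v])
  \<comment> \<open>This is \<open>(a' + 1) * (b' + 1) \<le> 36\<close> expanded;
    \<open>a' + b' \<ge> 36\<close> alone already violates it.\<close>
  then have "a' * b' + a' + b' \<le> 35"
    by (simp add: a' b' algebra_simps)
  moreover have "36 \<le> a' + b'" using ab c by (simp add: a' b')
  ultimately show False by simp
qed

section \<open>Test vectors spread over large cliques\<close>

text \<open>Some vertex of \<open>C'\<close> lies outside \<open>C\<close>, and it is adjacent to
  all of the intersection.\<close>

lemma maximal_cliques_Int_le:
  assumes G: "pair_graph G" and C: "maximal_clique G C" and C': "maximal_clique G C'" and ne: "C \<noteq> C'"
    and nbrs: "\<And>v. v \<in> pverts G \<Longrightarrow> v \<notin> C \<Longrightarrow> card {u \<in> C. (v, u) \<in> parcs G} \<le> t"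
  shows "card (C \<inter> C') \<le> t"
proof -
  interpret pair_graph G by fact
  have "\<not> C' \<subseteq> C"
    using C C' ne by (auto simp: maximal_clique_def)
  then obtain v where v: "v \<in> C'" "v \<notin> C" by blast
  have sub: "C \<subseteq> pverts G" "C' \<subseteq> pverts G"
    using C C' by (auto simp: maximal_clique_def graph_clique_def)
  have "C \<inter> C' \<subseteq> {u \<in> C. (v, u) \<in> parcs G}"
    using C' v by (auto simp: maximal_clique_def graph_clique_def)
  then have "card (C \<inter> C') \<le> card {u \<in> C. (v, u) \<in> parcs G}"
    using sub finite_subset[OF _ pair_finite_verts] by (intro card_mono) auto
  also have "\<dots> \<le> t" using nbrs v sub by blast
  finally show ?thesis .
qed

text \<open>Remove from each clique \<open>C\<close> its intersections with the other cliques, the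
  vertices of \<open>X\<close>, and the neighbours of those vertices of \<open>X\<close> that lie
  outside \<open>C\<close>. The bound \<open>t\<close> limits each loss, and \<open>m\<close>
  vertices survive. The set \<open>D C\<close> then stands in for the fat vertex of
  \<open>C\<close>: seen from \<open>X\<close>, it has the adjacencies of that vertex.\<close>

lemma cliques_spread:
  assumes G: "pair_graph G" and F: "finite F" "\<And>C. C \<in> F \<Longrightarrow> maximal_clique G C"
    and X: "X \<subseteq> pverts G" "finite X"
    and nbrs: "\<And>C v. C \<in> F \<Longrightarrow> v \<in> pverts G \<Longrightarrow> v \<notin> C \<Longrightarrow> card {u \<in> C. (v, u) \<in> parcs G} \<le> t"
    and size: "\<And>C. C \<in> F \<Longrightarrow> m + (card F - 1) * t + card X * (t + 1) \<le> card C"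
  obtains D where "\<And>C. C \<in> F \<Longrightarrow> D C \<subseteq> C - X" "\<And>C. C \<in> F \<Longrightarrow> card (D C) = m"
    "\<And>C C'. C \<in> F \<Longrightarrow> C' \<in> F \<Longrightarrow> C \<noteq> C' \<Longrightarrow> D C \<inter> C' = {}"
    "\<And>C x u. C \<in> F \<Longrightarrow> x \<in> X - C \<Longrightarrow> u \<in> D C \<Longrightarrow> (x, u) \<notin> parcs G"
proof -
  interpret pair_graph G by fact
  define R where "R C = C - (\<Union>C' \<in> F - {C}. C \<inter> C') - (X \<union> (\<Union>x \<in> X - C. {u \<in> C. (x, u) \<in> parcs G}))" for C
  have "\<exists>S \<subseteq> R C. card S = m" if C: "C \<in> F" for C
  proof -
    have finC: "finite C"
      using F(2)[OF C] finite_subset[OF _ pair_finite_verts] by (auto simp: maximal_clique_def graph_clique_def)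
    have "card (\<Union>C' \<in> F - {C}. C \<inter> C') \<le> (\<Sum>C' \<in> F - {C}. card (C \<inter> C'))"
      using F(1) by (intro card_UN_le) auto
    also have "\<dots> \<le> card (F - {C}) * t"
      using C F(2) nbrs[OF C] by (intro sum_bounded_above[THEN order_trans])
        (auto intro!: maximal_cliques_Int_le[OF G])
    finally have 1: "card (\<Union>C' \<in> F - {C}. C \<inter> C') \<le> (card F - 1) * t"
      using C F(1) by simp
    have "card (\<Union>x \<in> X - C. {u \<in> C. (x, u) \<in> parcs G}) \<le> (\<Sum>x \<in> X - C. card {u \<in> C. (x, u) \<in> parcs G})"
      using X(2) by (intro card_UN_le) auto
    also have "\<dots> \<le> card (X - C) * t"
      using X(1) nbrs[OF C] by (intro sum_bounded_above[THEN order_trans]) auto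
    also have "\<dots> \<le> card X * t"
      using X(2) by (intro mult_right_mono card_mono) auto
    finally have 2: "card (X \<union> (\<Union>x \<in> X - C. {u \<in> C. (x, u) \<in> parcs G})) \<le> card X + card X * t"
      by (intro order_trans[OF card_Un_le]) simp
    have "card C - card (\<Union>C' \<in> F - {C}. C \<inter> C') - card (X \<union> (\<Union>x \<in> X - C. {u \<in> C. (x, u) \<in> parcs G})) \<le> card (R C)"
      unfolding R_def using F(1) X(2) finC
      by (intro order_trans[OF diff_le_mono[OF diff_card_le_card_Diff] diff_card_le_card_Diff]) auto
    then have "m \<le> card (R C)"
      using 1 2 size[OF C] by simp
    then show ?thesis
      by (metis obtain_subset_with_card_n)
  qed
  then obtain D where D: "\<And>C. C \<in> F \<Longrightarrow> D C \<subseteq> R C" "\<And>C. C \<in> F \<Longrightarrow> card (D C) = m"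
    by metis
  show thesis
  proof (rule that[of D])
    show "D C \<inter> C' = {}" if "C \<in> F" "C' \<in> F" "C \<noteq> C'" for C C'
      using D(1)[OF that(1)] that by (auto simp: R_def)
    show "(x, u) \<notin> parcs G" if "C \<in> F" "x \<in> X - C" "u \<in> D C" for C x u
      using D(1)[OF that(1)] that by (auto simp: R_def)
    show "D C \<subseteq> C - X" if "C \<in> F" for C
      using D(1)[OF that] by (auto simp: R_def)
  qed (rule D(2))
qed

text \<open>The left side is \<open>- m\<close> times the value at \<open>y\<close> of the special
  matrix plus 3, as \<open>s C\<close> is the entry at \<open>C\<close> of the incidence matrix
  applied to \<open>y\<close>. The right side is the error: \<open>2 * (s C)^2\<close> from each set
  \<open>D C\<close>, and the edges between distinct such sets, at most \<open>m * t\<close> for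
  each ordered pair.\<close>

lemma test_vector_bound:
  fixes y :: "'a \<Rightarrow> real" and s :: "'a set \<Rightarrow> real" and m t :: nat
  assumes G: "pair_graph G" and lam: "-3 \<le> lambda_min G"
    and F: "finite F" "\<And>C. C \<in> F \<Longrightarrow> graph_clique G C"
    and X: "X \<subseteq> pverts G" "finite X"
    and nbrs: "\<And>C v. C \<in> F \<Longrightarrow> v \<in> pverts G \<Longrightarrow> v \<notin> C \<Longrightarrow> card {u \<in> C. (v, u) \<in> parcs G} \<le> t"
    and m: "0 < m"
    and D: "\<And>C. C \<in> F \<Longrightarrow> D C \<subseteq> C - X" "\<And>C. C \<in> F \<Longrightarrow> card (D C) = m"
    "\<And>C C'. C \<in> F \<Longrightarrow> C' \<in> F \<Longrightarrow> C \<noteq> C' \<Longrightarrow> D C \<inter> C' = {}"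
    "\<And>C x u. C \<in> F \<Longrightarrow> x \<in> X - C \<Longrightarrow> u \<in> D C \<Longrightarrow> (x, u) \<notin> parcs G"
  defines "s \<equiv> \<lambda>C. \<Sum>x \<in> X \<inter> C. y x"
  shows "m * ((\<Sum>C \<in> F. (s C)\<^sup>2) - (\<Sum>u \<in> X. \<Sum>v \<in> X. y u * y v * (if (u, v) \<in> parcs G then 1 else 0))
      - 3 * (\<Sum>x \<in> X. (y x)\<^sup>2))
    \<le> 2 * (\<Sum>C \<in> F. (s C)\<^sup>2) + t * ((\<Sum>C \<in> F. \<bar>s C\<bar>)\<^sup>2 - (\<Sum>C \<in> F. (s C)\<^sup>2))"
proof -
  interpret pair_graph G by fact
  let ?\<phi> = "shifted_form 3 G"
  let ?P = "\<Sum>C \<in> F. (s C)\<^sup>2" and ?L = "\<Sum>C \<in> F. \<bar>s C\<bar>"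
  let ?Q = "(\<Sum>u \<in> X. \<Sum>v \<in> X. y u * y v * (if (u, v) \<in> parcs G then 1 else 0)) + 3 * (\<Sum>x \<in> X. (y x)\<^sup>2)"
  let ?g = "\<lambda>v. \<Sum>x \<in> X. y x * indicator {x} v"
  let ?h = "\<lambda>v. \<Sum>C \<in> F. s C * indicator (D C) v"
  have gg: "?\<phi> ?g ?g = ?Q"
  proof -
    have 1: "?\<phi> (indicator {u}) (indicator {v}) = (if (u, v) \<in> parcs G then 1 else 0) + (if u = v then 3 else 0)"
      if "u \<in> X" for u v
    proof -
      have "{w \<in> {v}. (u, w) \<in> parcs G} = (if (u, v) \<in> parcs G then {v} else {})" by auto
      then show ?thesis
        using X(1) that by (subst shifted_form_vertex[OF G]) auto
    qed
    have "?\<phi> ?g ?g = (\<Sum>u \<in> X. \<Sum>v \<in> X. y u * (y v * ?\<phi> (indicator {u}) (indicator {v})))"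
      by (simp only: shifted_form_sum_left shifted_form_sum_right shifted_form_mult_left
          shifted_form_mult_right sum_distrib_left)
    also have "\<dots> = (\<Sum>u \<in> X. \<Sum>v \<in> X. y u * y v * (if (u, v) \<in> parcs G then 1 else 0)
        + (if u = v then 3 * (y u)\<^sup>2 else 0))"
      by (intro sum.cong) (auto simp: 1 power2_eq_square algebra_simps)
    also have "\<dots> = ?Q"
      using X(2) by (simp add: sum.distrib sum_distrib_left)
    finally show ?thesis .
  qed
  \<comment> \<open>The cross term is exact: a vertex of \<open>X\<close> is adjacent to all of
    \<open>D C\<close> if it lies in \<open>C\<close> and to none of it otherwise.\<close>
  have gh: "?\<phi> ?g ?h = m * ?P"
  proof -
    have 1: "?\<phi> (indicator {x}) (indicator (D C)) = (if x \<in> C then m else 0)"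
      if x: "x \<in> X" and C: "C \<in> F" for x C
    proof -
      have "x \<notin> D C" using D(1)[OF C] x by auto
      moreover have "{u \<in> D C. (x, u) \<in> parcs G} = (if x \<in> C then D C else {})"
      proof (cases "x \<in> C")
        case True
        have "(x, u) \<in> parcs G" if u: "u \<in> D C" for u
        proof -
          have "u \<in> C" "x \<noteq> u"
            using subsetD[OF D(1)[OF C] u] x by auto
          moreover have "\<forall>w \<in> C. \<forall>z \<in> C. w \<noteq> z \<longrightarrow> (w, z) \<in> parcs G"
            using F(2)[OF C] unfolding graph_clique_def by (rule conjunct2)
          ultimately show ?thesis
            using True by simp
        qed
        with True show ?thesis by auto
      next
        case False
        then show ?thesis using D(4)[OF C] x by auto
      qed
      ultimately show ?thesis
        using X(1) x D(2)[OF C] by (subst shifted_form_vertex[OF G]) auto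
    qed
    have "?\<phi> ?g ?h = (\<Sum>C \<in> F. s C * (\<Sum>x \<in> X. y x * ?\<phi> (indicator {x}) (indicator (D C))))"
      by (simp only: shifted_form_sum_left shifted_form_sum_right shifted_form_mult_left
          shifted_form_mult_right sum_distrib_left) (subst sum.swap, simp only: mult.left_commute)
    also have "\<dots> = (\<Sum>C \<in> F. s C * (\<Sum>x \<in> X. if x \<in> C then m * y x else 0))"
      by (intro sum.cong arg_cong2[where f = "(*)"] refl) (auto simp: 1)
    also have "\<dots> = (\<Sum>C \<in> F. s C * (m * s C))"
      unfolding s_def using X(2) by (simp add: sum.inter_restrict sum_distrib_left if_distrib cong: if_cong)
    also have "\<dots> = m * ?P"
      by (simp add: sum_distrib_left power2_eq_square mult.left_commute)
    finally show ?thesis .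
  qed
  have hh: "?\<phi> ?h ?h \<le> m * t * ?L\<^sup>2 + (real m * m + 2 * m - m * t) * ?P"
  proof -
    \<comment> \<open>For \<open>C \<noteq> C'\<close> each vertex of \<open>D C\<close> lies
      outside \<open>C'\<close> and so has at most \<open>t\<close> neighbours there. The summand
      \<open>- m * t\<close> for \<open>C = C'\<close> compensates for the diagonal, so that the
      first terms add up to the full square \<open>?L^2\<close>.\<close>
    have 1: "s C * (s C' * ?\<phi> (indicator (D C)) (indicator (D C')))
      \<le> m * t * (\<bar>s C\<bar> * \<bar>s C'\<bar>) + (if C = C' then (real m * m + 2 * m - m * t) * (s C)\<^sup>2 else 0)"
      if C: "C \<in> F" and C': "C' \<in> F" for C C'
    proof (cases "C = C'")
      case True
      have "?\<phi> (indicator (D C)) (indicator (D C)) = real m * m + 2 * m"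
        using shifted_form_clique[OF G F(2)[OF C], of "D C" "D C" 3] D(1,2)[OF C] by auto
      then show ?thesis
        using True by (simp add: power2_eq_square algebra_simps flip: abs_mult)
    next
      case False
      have sub: "D C \<subseteq> pverts G" "D C \<inter> C' = {}" "D C' \<subseteq> C'" "finite C'"
        using D(1)[OF C] D(1)[OF C'] D(3)[OF C C' False] F(2)[OF C] F(2)[OF C']
          finite_subset[OF _ pair_finite_verts]
        by (auto simp: graph_clique_def)
      have finD: "finite (D C)"
        using D(2)[OF C] m by (intro card_ge_0_finite) simp
      have "{e \<in> parcs G. fst e \<in> D C \<and> snd e \<in> D C'} \<subseteq> (SIGMA v : D C. {u \<in> C'. (v, u) \<in> parcs G})"
        using sub by auto
      then have "card {e \<in> parcs G. fst e \<in> D C \<and> snd e \<in> D C'} \<le> card (SIGMA v : D C. {u \<in> C'. (v, u) \<in> parcs G})"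
        using sub finD by (intro card_mono finite_SigmaI) auto
      also have "\<dots> = (\<Sum>v \<in> D C. card {u \<in> C'. (v, u) \<in> parcs G})"
        using sub finD by (intro card_SigmaI) auto
      also have "\<dots> \<le> (\<Sum>v \<in> D C. t)"
        using sub nbrs[OF C'] by (intro sum_mono) auto
      finally have "card {e \<in> parcs G. fst e \<in> D C \<and> snd e \<in> D C'} \<le> m * t"
        using D(2)[OF C] by simp
      moreover have "D C \<inter> D C' = {}"
        using sub by blast
      ultimately have b: "\<bar>?\<phi> (indicator (D C)) (indicator (D C'))\<bar> \<le> m * t"
        using shifted_form_indicator[OF G sub(1), of 3 "D C'"] by (simp flip: of_nat_mult)
      have "s C * (s C' * ?\<phi> (indicator (D C)) (indicator (D C')))
          \<le> \<bar>s C\<bar> * \<bar>s C'\<bar> * \<bar>?\<phi> (indicator (D C)) (indicator (D C'))\<bar>"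
        by (metis abs_ge_self abs_mult mult.assoc)
      also have "\<dots> \<le> \<bar>s C\<bar> * \<bar>s C'\<bar> * (m * t)"
        by (intro mult_left_mono b) auto
      finally show ?thesis
        using False by (simp add: mult.commute)
    qed
    have "?\<phi> ?h ?h = (\<Sum>C \<in> F. \<Sum>C' \<in> F. s C * (s C' * ?\<phi> (indicator (D C)) (indicator (D C'))))"
      by (simp only: shifted_form_sum_left shifted_form_sum_right shifted_form_mult_left
          shifted_form_mult_right sum_distrib_left)
    also have "\<dots> \<le> (\<Sum>C \<in> F. \<Sum>C' \<in> F. m * t * (\<bar>s C\<bar> * \<bar>s C'\<bar>)
        + (if C = C' then (real m * m + 2 * m - m * t) * (s C)\<^sup>2 else 0))"
      by (intro sum_mono 1)
    also have "\<dots> = m * t * ?L\<^sup>2 + (real m * m + 2 * m - m * t) * ?P"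
      using F(1) by (simp add: sum.distrib power2_eq_square sum_product sum_distrib_left sum_distrib_right mult_ac)
    finally show ?thesis .
  qed
  let ?f = "\<lambda>v. m * ?g v + (- 1) * ?h v"
  have "0 \<le> ?\<phi> ?f ?f"
    by (rule shifted_form_nonneg[OF G lam])
  also have "?\<phi> ?f ?f = m * (m * ?\<phi> ?g ?g + (- 1) * ?\<phi> ?g ?h) + (- 1) * (m * ?\<phi> ?g ?h + (- 1) * ?\<phi> ?h ?h)"
    by (simp only: shifted_form_add_left shifted_form_add_right shifted_form_mult_left
        shifted_form_mult_right shifted_form_commute[OF G, of 3 ?h ?g] distrib_left)
  \<comment> \<open>The cross terms give \<open>- 2 * m^2 * ?P\<close> and the cliques return
    \<open>m^2 * ?P\<close>; what remains is the contribution of the fat vertices to the special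
    matrix.\<close>
  also have "\<dots> \<le> real m * (m * ?Q - m * ?P + 2 * ?P + t * (?L\<^sup>2 - ?P))"
    using hh unfolding gg gh by (simp add: algebra_simps)
  finally have "0 \<le> m * ?Q - m * ?P + 2 * ?P + t * (?L\<^sup>2 - ?P)"
    using m by (subst (asm) zero_le_mult_iff) auto
  then show ?thesis
    unfolding right_diff_distrib distrib_left by linarith
qed

section \<open>Nonnegativity of special matrices with few incidences\<close>

text \<open>All quantities are integers, so a negative value of the special matrix plus 3 at
  \<open>y\<close> is at most -1; multiplied by \<open>m\<close> it exceeds the error in
  \<open>test_vector_bound\<close>, which the bound 6 on the incidences keeps small.\<close>

lemma special_form_nonneg:
  fixes y :: "'a \<Rightarrow> int" and t :: nat
  assumes G: "pair_graph G" and lam: "-3 \<le> lambda_min G"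
    and F: "finite F" "\<And>C. C \<in> F \<Longrightarrow> maximal_clique G C" "\<And>C. C \<in> F \<Longrightarrow> 50 * t + 16 \<le> card C"
    and t: "1 \<le> t"
    and nbrs: "\<And>C v. C \<in> F \<Longrightarrow> v \<in> pverts G \<Longrightarrow> v \<notin> C \<Longrightarrow> card {u \<in> C. (v, u) \<in> parcs G} \<le> t"
    and X: "X \<subseteq> pverts G" "card X \<le> 3" "finite X"
    and meets: "\<And>C. C \<in> F \<Longrightarrow> X \<inter> C \<noteq> {}"
    and inc: "(\<Sum>x \<in> X. card {C \<in> F. x \<in> C}) \<le> 6"
    and y: "\<And>x. x \<in> X \<Longrightarrow> \<bar>y x\<bar> = 1"
  shows "- 3 * int (card X) \<le> (\<Sum>u \<in> X. \<Sum>v \<in> X. y u * y v *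
    ((if (u, v) \<in> parcs G then 1 else 0) - int (card {C \<in> F. u \<in> C \<and> v \<in> C})))"
proof -
  \<comment> \<open>This is what \<open>50 * t + 16\<close> leaves after the loss of at most
    \<open>5 * t + 3 * (t + 1)\<close> vertices in \<open>cliques_spread\<close>, for at most six
    cliques and three vertices.\<close>
  let ?m = "42 * t + 13"
  define s where "s C = (\<Sum>x \<in> X \<inter> C. y x)" for C
  define P where "P = (\<Sum>C \<in> F. (s C)\<^sup>2)"
  define L where "L = (\<Sum>C \<in> F. \<bar>s C\<bar>)"
  define A where "A = (\<Sum>u \<in> X. \<Sum>v \<in> X. y u * y v * (if (u, v) \<in> parcs G then 1 else 0))"
  have "card F \<le> card (\<Union>x \<in> X. {C \<in> F. x \<in> C})"
    using F(1) X(3) meets by (intro card_mono) auto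
  also have "\<dots> \<le> 6"
    using X(3) by (intro order_trans[OF card_UN_le inc])
  finally have F_le: "(card F - 1) * t \<le> 5 * t" by (intro mult_right_mono) auto
  have X_le: "card X * (t + 1) \<le> 3 * (t + 1)"
    using X(2) by (intro mult_right_mono) auto
  have "?m + (card F - 1) * t + card X * (t + 1) \<le> card C" if "C \<in> F" for C
  proof -
    have "?m + ((card F - 1) * t + card X * (t + 1)) \<le> ?m + (5 * t + 3 * (t + 1))"
      by (intro add_left_mono add_mono F_le X_le)
    also have "\<dots> \<le> card C"
      using F(3)[OF that] by simp
    finally show ?thesis
      by (simp only: add.assoc)
  qed
  from cliques_spread[OF G F(1,2) X(1,3) nbrs this]
  obtain D where D: "\<And>C. C \<in> F \<Longrightarrow> D C \<subseteq> C - X" "\<And>C. C \<in> F \<Longrightarrow> card (D C) = ?m"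
    "\<And>C C'. C \<in> F \<Longrightarrow> C' \<in> F \<Longrightarrow> C \<noteq> C' \<Longrightarrow> D C \<inter> C' = {}"
    "\<And>C x u. C \<in> F \<Longrightarrow> x \<in> X - C \<Longrightarrow> u \<in> D C \<Longrightarrow> (x, u) \<notin> parcs G"
    by blast
  have cl: "\<And>C. C \<in> F \<Longrightarrow> graph_clique G C"
    using F(2) by (simp add: maximal_clique_def)
  have y2: "(y x)\<^sup>2 = 1" if "x \<in> X" for x
    using y[OF that] by (metis power2_abs power_one)
  have "real_of_int (?m * (P - A - 3 * card X)) \<le> real_of_int (2 * P + t * (L\<^sup>2 - P))"
  proof -
    have "(\<Sum>x \<in> X. (real_of_int (y x))\<^sup>2) = card X"
      using y2 by (simp flip: of_int_power)
    moreover have "real_of_int A = (\<Sum>u \<in> X. \<Sum>v \<in> X. real_of_int (y u) * real_of_int (y v) *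
        (if (u, v) \<in> parcs G then 1 else 0))"
      unfolding A_def of_int_sum by (intro sum.cong refl) auto
    moreover have "real_of_int P = (\<Sum>C \<in> F. (\<Sum>x \<in> X \<inter> C. real_of_int (y x))\<^sup>2)"
      "real_of_int L = (\<Sum>C \<in> F. \<bar>\<Sum>x \<in> X \<inter> C. real_of_int (y x)\<bar>)"
      by (simp_all add: P_def L_def s_def)
    ultimately show ?thesis
      using test_vector_bound[where y = "\<lambda>x. real_of_int (y x)" and m = "?m",
          OF G lam F(1) cl X(1,3) nbrs _ D] by simp
  qed
  then have bound: "?m * (P - A - 3 * card X) \<le> 2 * P + t * (L\<^sup>2 - P)"
    unfolding of_int_le_iff .
  have s_le: "\<bar>s C\<bar> \<le> card (X \<inter> C)" for C
  proof -
    have "\<bar>s C\<bar> \<le> (\<Sum>x \<in> X \<inter> C. \<bar>y x\<bar>)"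
      unfolding s_def by (rule sum_abs)
    also have "\<dots> = card (X \<inter> C)" using y by simp
    finally show ?thesis .
  qed
  have card_Int: "card (X \<inter> C) = (\<Sum>x \<in> X. if x \<in> C then 1 else 0)" for C
    using X(3) by (simp add: sum.If_cases Int_def)
  \<comment> \<open>Counting incidences by cliques instead of by vertices turns \<open>inc\<close>
    into a bound on \<open>L\<close>.\<close>
  have "(\<Sum>C \<in> F. card (X \<inter> C)) = (\<Sum>x \<in> X. card {C \<in> F. x \<in> C})"
    unfolding card_Int by (subst sum.swap) (use F(1) in \<open>simp add: sum.If_cases Int_def\<close>)
  with inc have inc': "(\<Sum>C \<in> F. int (card (X \<inter> C))) \<le> 6"
    by (simp flip: of_nat_sum)
  have L: "0 \<le> L" "L \<le> 6"
    using inc' sum_mono[of F "\<lambda>C. \<bar>s C\<bar>", OF s_le] by (auto simp: L_def sum_nonneg)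
  have "(s C)\<^sup>2 \<le> 3 * \<bar>s C\<bar>" for C
  proof -
    have "card (X \<inter> C) \<le> card X" using X(3) by (intro card_mono) auto
    then have "\<bar>s C\<bar> \<le> 3" using s_le[of C] X(2) by simp
    then have "\<bar>s C\<bar> * \<bar>s C\<bar> \<le> 3 * \<bar>s C\<bar>" by (intro mult_right_mono) auto
    then show ?thesis by (simp add: power2_eq_square)
  qed
  then have "P \<le> 3 * L"
    unfolding P_def L_def sum_distrib_left by (intro sum_mono)
  with L have P: "0 \<le> P" "P \<le> 18"
    by (auto simp: P_def sum_nonneg)
  have "L\<^sup>2 \<le> 6\<^sup>2" using L by (intro power_mono)
  then have "t * (L\<^sup>2 - P) \<le> t * (36 - P)"
    by (intro mult_left_mono) auto
  with bound have *: "?m * (P - A - 3 * card X) \<le> 2 * P + t * (36 - P)" by linarith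
  \<comment> \<open>If this failed, the left side of \<open>*\<close> would be at least
    \<open>?m\<close>, hence \<open>6 * t + 13 \<le> (2 - t) * P\<close>. For \<open>t = 1\<close>
    this needs \<open>P \<ge> 19\<close>, just beyond \<open>P \<le> 18\<close>; for larger
    \<open>t\<close> the right side is not positive.\<close>
  have "P - A - 3 * card X \<le> 0"
  proof (rule ccontr)
    assume "\<not> ?thesis"
    then have "int ?m * 1 \<le> int ?m * (P - A - 3 * card X)"
      by (intro mult_left_mono) auto
    with * have **: "6 * int t + 13 \<le> 2 * P - t * P"
      by (simp add: algebra_simps)
    show False
    proof (cases "t = 1")
      case True
      with ** P show False by simp
    next
      case False
      with t have "2 * P \<le> t * P" using P by (intro mult_right_mono) auto
      with ** show False by linarith
    qed
  qed
  moreover have "P = (\<Sum>u \<in> X. \<Sum>v \<in> X. y u * y v * int (card {C \<in> F. u \<in> C \<and> v \<in> C}))"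
  proof -
    have s': "s C = (\<Sum>x \<in> X. if x \<in> C then y x else 0)" for C
      unfolding s_def using X(3) by (simp add: sum.inter_restrict)
    have "P = (\<Sum>C \<in> F. \<Sum>u \<in> X. \<Sum>v \<in> X. y u * y v * (if u \<in> C \<and> v \<in> C then 1 else 0))"
      unfolding P_def s' power2_eq_square sum_product by (intro sum.cong refl) auto
    also have "\<dots> = (\<Sum>u \<in> X. \<Sum>v \<in> X. \<Sum>C \<in> F. y u * y v * (if u \<in> C \<and> v \<in> C then 1 else 0))"
      by (subst sum.swap, rule sum.cong[OF refl], rule sum.swap)
    also have "\<dots> = (\<Sum>u \<in> X. \<Sum>v \<in> X. y u * y v * int (card {C \<in> F. u \<in> C \<and> v \<in> C}))"
      using F(1) by (simp add: sum.If_cases Int_def flip: sum_distrib_left)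
    finally show ?thesis .
  qed
  ultimately show ?thesis
    by (simp add: A_def right_diff_distrib sum_subtractf)
qed

section \<open>The matrices of \<open>M2\<close> as special matrices\<close>

text \<open>The signs make every off-diagonal entry \<open>e i * e j * M $$ (i, j)\<close>
  nonpositive. The trace matters because its negative counts the incidences of slim with fat
  vertices. For 1 by 1 matrices it is unbounded below, hence the separate alternative.\<close>

lemma M2_signs:
  assumes "M \<in> M2"
  shows "dim_row M = 1 \<and> M $$ (0, 0) \<le> -4 \<or>
    dim_row M \<le> 3 \<and> -6 \<le> (\<Sum>i < dim_row M. M $$ (i, i)) \<and>
    (\<exists>e :: nat \<Rightarrow> int. (\<forall>i. \<bar>e i\<bar> = 1) \<and>
      (\<Sum>i < dim_row M. \<Sum>j < dim_row M. e i * e j * M $$ (i, j)) < - 3 * int (dim_row M))"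
proof -
  have signs: ?thesis
    if "dim_row M \<le> 3" "-6 \<le> (\<Sum>i < dim_row M. M $$ (i, i))" "\<And>i. \<bar>e i\<bar> = 1"
      "(\<Sum>i < dim_row M. \<Sum>j < dim_row M. e i * e j * M $$ (i, j)) < - 3 * int (dim_row M)"
    for e :: "nat \<Rightarrow> int"
    using that by blast
  note [simp] = mat_of_rows_list_def numeral_eq_Suc
  consider a where "a \<le> -2" "M = mat_of_rows_list 1 [[-2 + a]]"
    | a where "a \<le> -2" "M = mat_of_rows_list 2 [[-2, a], [a, -2]]"
    | a where "a = 1 \<or> a \<le> -1" "M = mat_of_rows_list 2 [[-3, a], [a, -2]]"
    | a where "a = 1 \<or> a \<le> -1" "M = mat_of_rows_list 2 [[-3, a], [a, -3]]"
    | "M = mat_of_rows_list 3 [[-2, -1, -1], [-1, -2, -1], [-1, -1, -2]]"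
    | "M = mat_of_rows_list 3 [[-2, 1, 1], [1, -2, -1], [1, -1, -2]]"
    | "M = mat_of_rows_list 3 [[-2, 0, 1], [0, -2, -1], [1, -1, -2]]"
    | "M = mat_of_rows_list 3 [[-2, 0, 1], [0, -2, 1], [1, 1, -2]]"
    | "M = mat_of_rows_list 3 [[-2, 0, -1], [0, -2, -1], [-1, -1, -2]]"
    using assms unfolding M2_def by blast
  then show ?thesis
  proof cases
    case 1
    then show ?thesis by simp
  next
    case (2 a)
    then show ?thesis by (intro signs[of "\<lambda>_. 1"]) simp_all
  next
    case (3 a)
    then show ?thesis by (intro signs[of "\<lambda>i. if i = 0 \<and> a = 1 then -1 else 1"]) auto
  next
    case (4 a)
    then show ?thesis by (intro signs[of "\<lambda>i. if i = 0 \<and> a = 1 then -1 else 1"]) auto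
  next
    case 5
    then show ?thesis by (intro signs[of "\<lambda>_. 1"]) simp_all
  next
    case 6
    then show ?thesis by (intro signs[of "\<lambda>i. if i = 0 then -1 else 1"]) simp_all
  next
    case 7
    then show ?thesis by (intro signs[of "\<lambda>i. if i = 0 then -1 else 1"]) simp_all
  next
    case 8
    then show ?thesis by (intro signs[of "\<lambda>i. if i = 2 then -1 else 1"]) simp_all
  next
    case 9
    then show ?thesis by (intro signs[of "\<lambda>_. 1"]) simp_all
  qed
qed

text \<open>Translation back to \<open>G\<close>: slim vertices become the list \<open>xs\<close>,
  fat vertices the set \<open>F\<close> of cliques, and common fat neighbours become cliques of
  \<open>F\<close> through both vertices.\<close>

lemma special_matrix_induced:
  assumes h: "induced_hoffman_subgraph h (associated_hoffman_graph G q)"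
    and fs: "fs \<in> permutations_of_set (fats h)" and ss: "ss \<in> permutations_of_set (slims h)"
  obtains xs F where "distinct xs" "set xs \<subseteq> pverts G" "length xs = dim_row (special_matrix h fs ss)"
    "finite F" "F \<subseteq> large_maximal_cliques G q" "\<And>C. C \<in> F \<Longrightarrow> set xs \<inter> C \<noteq> {}"
    "\<And>i j. i < length xs \<Longrightarrow> j < length xs \<Longrightarrow> special_matrix h fs ss $$ (i, j) =
      (if (xs ! i, xs ! j) \<in> parcs G then 1 else 0) - int (card {C \<in> F. xs ! i \<in> C \<and> xs ! j \<in> C})"
proof -
  let ?H = "associated_hoffman_graph G q"
  have hh: "is_hoffman_graph h" and fat: "fats h = fats ?H \<inter> pverts (hgraph h)"
    and sub: "pverts (hgraph h) \<subseteq> pverts (hgraph ?H)"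
    and arcs: "parcs (hgraph h) = {e \<in> parcs (hgraph ?H). fst e \<in> pverts (hgraph h) \<and> snd e \<in> pverts (hgraph h)}"
    using h by (auto simp: induced_hoffman_subgraph_def induced_subgraph_def subgraph_def)
  have slim: "slims h \<subseteq> Inl ` pverts G"
    using sub fat by (auto simp: slims_def associated_hoffman_graph_def)
  define F where "F = {C. Inr C \<in> fats h}"
  define xs where "xs = map projl ss"
  have set_ss: "set ss = slims h" "distinct ss" "set fs = fats h" "distinct fs"
    using fs ss by (auto simp: permutations_of_set_def)
  have nth: "ss ! i = Inl (xs ! i)" if "i < length xs" for i
    using that slim set_ss(1) nth_mem[of i ss] by (auto simp: xs_def)
  have fats_F: "fats h = Inr ` F"
    using fat by (auto simp: F_def associated_hoffman_graph_def)
  have xs_mem: "Inl (xs ! i) \<in> slims h" if "i < length xs" for i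
  proof -
    have "ss ! i \<in> slims h"
      using that nth_mem[of i ss] set_ss(1) by (simp add: xs_def)
    then show ?thesis unfolding nth[OF that] .
  qed
  have "(Inl u, Inl v) \<in> parcs (hgraph ?H) \<longleftrightarrow> (u, v) \<in> parcs G" for u v
    by (simp add: associated_hoffman_graph_def)
  then have arc_slim: "(ss ! i, ss ! j) \<in> parcs (hgraph h) \<longleftrightarrow> (xs ! i, xs ! j) \<in> parcs G"
    if "i < length xs" "j < length xs" for i j
    unfolding arcs nth[OF that(1)] nth[OF that(2)]
    using xs_mem[OF that(1)] xs_mem[OF that(2)] by (simp add: slims_def)
  have "(Inr C, Inl x) \<in> parcs (hgraph ?H) \<longleftrightarrow> C \<in> large_maximal_cliques G q \<and> x \<in> C" for C x
    by (simp add: associated_hoffman_graph_def)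
  moreover have F_large: "C \<in> large_maximal_cliques G q" "Inr C \<in> pverts (hgraph h)" if "C \<in> F" for C
    using that fat by (auto simp: F_def associated_hoffman_graph_def)
  ultimately have arc_fat: "(Inr C, Inl x) \<in> parcs (hgraph h) \<longleftrightarrow> x \<in> C"
    if "C \<in> F" "Inl x \<in> slims h" for C x
    using that F_large[OF that(1)] unfolding arcs by (simp add: slims_def)
  show thesis
  proof (rule that[of xs F])
    show "distinct xs"
    proof -
      have "inj_on projl (Inl ` pverts G)"
        by (auto simp: inj_on_def)
      then show ?thesis
        using set_ss(1,2) inj_on_subset[OF _ slim] by (simp add: xs_def distinct_map)
    qed
    show "set xs \<subseteq> pverts G"
      using set_ss slim by (auto simp: xs_def)
    show "length xs = dim_row (special_matrix h fs ss)"
      by (simp add: special_matrix_def fat_slim_incidence_matrix_def xs_def)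
    show "finite F"
      using set_ss(3) unfolding fats_F by (metis finite_imageD finite_set inj_Inr inj_on_subset subset_UNIV)
    show "F \<subseteq> large_maximal_cliques G q"
      using F_large by blast
    \<comment> \<open>Here it matters that the subgraph is a Hoffman graph itself, so that the fat
      vertex of \<open>C\<close> keeps a slim neighbour.\<close>
    show "set xs \<inter> C \<noteq> {}" if C: "C \<in> F" for C
    proof -
      obtain s where s: "s \<in> slims h" "(Inr C, s) \<in> parcs (hgraph h)"
        using hh C fats_F by (auto simp: is_hoffman_graph_def)
      with slim obtain x where x: "s = Inl x" by blast
      then have "x \<in> set xs"
        using s(1) set_ss(1) by (force simp: xs_def)
      then show ?thesis using arc_fat[OF C] s x by auto
    qed
    show "special_matrix h fs ss $$ (i, j) =
      (if (xs ! i, xs ! j) \<in> parcs G then 1 else 0) - int (card {C \<in> F. xs ! i \<in> C \<and> xs ! j \<in> C})"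
      if ij: "i < length xs" "j < length xs" for i j
    proof -
      have "{f \<in> set fs. (f, ss ! i) \<in> parcs (hgraph h) \<and> (f, ss ! j) \<in> parcs (hgraph h)}
          = Inr ` {C \<in> F. xs ! i \<in> C \<and> xs ! j \<in> C}"
        unfolding set_ss(3) fats_F nth[OF ij(1)] nth[OF ij(2)] using arc_fat xs_mem ij by auto
      then show ?thesis
        using ij special_matrix_index[OF set_ss(4), of i ss j h] arc_slim[OF ij]
        by (simp add: xs_def card_image)
    qed
  qed
qed

theorem theorem3p8:
  fixes c c' q :: nat and G :: "'a pair_pre_digraph"
  assumes "c > 0" "c' > 0" "q > 0"
    and "c' = min c 6"
    and "q \<ge> max (c + 5) (50 * c' + 16)"
    and "pair_graph G"
    and "mu_bounded G c"
    and "lambda_min G \<ge> -3"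
  shows "\<not> (\<exists>h. induced_hoffman_subgraph h (associated_hoffman_graph G q)
               \<and> special_matrix_belongs h M2)"
proof
  assume "\<exists>h. induced_hoffman_subgraph h (associated_hoffman_graph G q) \<and> special_matrix_belongs h M2"
  then obtain h fs ss where h: "induced_hoffman_subgraph h (associated_hoffman_graph G q)"
    and fs: "fs \<in> permutations_of_set (fats h)" and ss: "ss \<in> permutations_of_set (slims h)"
    and M2: "special_matrix h fs ss \<in> M2"
    by (auto simp: special_matrix_belongs_def)
  define M where "M = special_matrix h fs ss"
  obtain xs F where xs: "distinct xs" "set xs \<subseteq> pverts G" "length xs = dim_row M"
    and F: "finite F" "F \<subseteq> large_maximal_cliques G q" "\<And>C. C \<in> F \<Longrightarrow> set xs \<inter> C \<noteq> {}"
    and entry: "\<And>i j. i < length xs \<Longrightarrow> j < length xs \<Longrightarrow> M $$ (i, j) =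
      (if (xs ! i, xs ! j) \<in> parcs G then 1 else 0) - int (card {C \<in> F. xs ! i \<in> C \<and> xs ! j \<in> C})"
    using special_matrix_induced[OF h fs ss] unfolding M_def by blast
  interpret pair_graph G by fact
  have diag: "M $$ (i, i) = - int (card {C \<in> F. xs ! i \<in> C})" if "i < length xs" for i
    using entry[OF that that] pair_no_loops[of "(xs ! i, xs ! i)"] by auto
  have large: "maximal_clique G C" "q \<le> card C" if "C \<in> F" for C
    using that F(2) by (auto simp: large_maximal_cliques_def)
  have size: "50 * c' + 16 \<le> card C" if "C \<in> F" for C
    using large(2)[OF that] assms(5) by simp
  \<comment> \<open>If \<open>c > 6\<close> then \<open>c' = 6\<close> and
    \<open>q \<ge> 316\<close>, so one of the two alternatives in \<open>clique_nbrs_le\<close>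
    always holds.\<close>
  have nbrs: "card {u \<in> C. (v, u) \<in> parcs G} \<le> c'" if "C \<in> F" "v \<in> pverts G" "v \<notin> C" for C v
    unfolding assms(4) using that assms large[OF that(1)]
    by (intro clique_nbrs_le) (auto simp: min_def split: if_splits)
  from M2_signs[OF M2[folded M_def]] show False
  proof (elim disjE conjE exE)
    assume dim: "dim_row M = 1" and M: "M $$ (0, 0) \<le> -4"
    define x where "x = xs ! 0"
    have x: "x \<in> pverts G"
      using xs dim nth_mem[of 0 xs] by (auto simp: x_def)
    have "4 \<le> card {C \<in> F. x \<in> C}"
      using M diag[of 0] xs(3) dim by (simp add: x_def)
    \<comment> \<open>Four of the cliques through \<open>x\<close> suffice: they respect the bound 6
      on incidences and already give the value -4, below -3.\<close>
    then obtain F' where F': "F' \<subseteq> {C \<in> F. x \<in> C}" "card F' = 4"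
      by (meson obtain_subset_with_card_n)
    then have eq: "{C \<in> F'. x \<in> C} = F'" by auto
    have "- 3 * int (card {x}) \<le> (\<Sum>u \<in> {x}. \<Sum>v \<in> {x}. 1 * 1 *
        ((if (u, v) \<in> parcs G then 1 else 0) - int (card {C \<in> F'. u \<in> C \<and> v \<in> C})))"
    proof (rule special_form_nonneg[where t = c' and y = "\<lambda>_. 1"])
      show "finite F'" using F(1) by (intro finite_subset[OF F'(1)]) auto
    qed (use F' eq assms x large(1) size nbrs in auto)
    then show False
      using F'(2) eq pair_no_loops[of "(x, x)"] by (simp split: if_splits)
  next
    fix e :: "nat \<Rightarrow> int"
    assume dim: "dim_row M \<le> 3" and tr: "-6 \<le> (\<Sum>i < dim_row M. M $$ (i, i))"
      and e: "\<forall>i. \<bar>e i\<bar> = 1"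
      and neg: "(\<Sum>i < dim_row M. \<Sum>j < dim_row M. e i * e j * M $$ (i, j)) < - 3 * int (dim_row M)"
    have bij: "bij_betw ((!) xs) {..<dim_row M} (set xs)"
      using xs by (intro bij_betw_nth) auto
    define y where "y x = e (the_inv_into {..<dim_row M} ((!) xs) x)" for x
    have y: "y (xs ! i) = e i" if "i < dim_row M" for i
      using that bij by (simp add: y_def the_inv_into_f_f bij_betw_def)
    let ?S = "\<lambda>u v. (if (u, v) \<in> parcs G then 1 else 0) - int (card {C \<in> F. u \<in> C \<and> v \<in> C})"
    \<comment> \<open>Each diagonal entry is minus the number of cliques through its vertex, so the
      trace bound becomes the incidence bound.\<close>
    have "(\<Sum>i < dim_row M. M $$ (i, i)) = - int (\<Sum>i < dim_row M. card {C \<in> F. xs ! i \<in> C})"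
      using diag xs(3) by (simp add: sum_negf)
    also have "(\<Sum>i < dim_row M. card {C \<in> F. xs ! i \<in> C}) = (\<Sum>x \<in> set xs. card {C \<in> F. x \<in> C})"
      by (rule sum.reindex_bij_betw[OF bij])
    finally have inc: "(\<Sum>x \<in> set xs. card {C \<in> F. x \<in> C}) \<le> 6"
      using tr by linarith
    have "card (set xs) = dim_row M"
      using xs by (simp add: distinct_card)
    moreover have "- 3 * int (card (set xs)) \<le> (\<Sum>u \<in> set xs. \<Sum>v \<in> set xs. y u * y v * ?S u v)"
      using calculation dim inc F e assms xs large(1) size nbrs
      by (intro special_form_nonneg[where t = c']) (auto simp: y_def)
    moreover have "(\<Sum>u \<in> set xs. \<Sum>v \<in> set xs. y u * y v * ?S u v)
        = (\<Sum>i < dim_row M. \<Sum>j < dim_row M. e i * e j * M $$ (i, j))"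
      unfolding sum.reindex_bij_betw[OF bij, symmetric]
      using entry xs(3) y by (intro sum.cong refl) simp
    ultimately show False
      using neg by simp
  qed
qed

end
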